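(* Let $X$ be an infinite-dimensional real Banach space, $I=[0,a]$ with $a>0$, and let $G\subset C(I,X)$ be a nonempty equi-continuous subset with $\sup_{g\in G}\|g(t)\|<\infty$ for almost all $t\in I$. Then $\mathbb J_G:I\to C_b(\Omega)$ is continuous, hence strongly measurable.
   Context: $\Omega=B_{X^*}$ with the norm topology, $C_b(\Omega)$ is the Banach space of bounded continuous real functions on $\Omega$ with the sup-norm. $\mathbb J_G$ is defined by $\mathbb J_G(t)(x^* )=\sup_{g\in G}\langle x^*,g(t)\rangle$, $x^*\in\Omega$. Strongly measurable (for Lebesgue measure on $I$) means being the a.e. norm-limit of a sequence of simple functions. *)

theory Defs
  imports "HOL-Analysis.Analysis"
begin

(* The closed unit ball of the normed dual of 'a, as a metric space of its own, so that C_b of it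
   is the library's type of bounded continuous functions with its supremum norm. *)
typedef (overloaded) 'a dual_ball = "cball 0 1 :: ('a::real_normed_vector \<Rightarrow>\<^sub>L real) set"
  morphisms functional_of Dual_Ball
  by (rule exI[of _ 0]) simp

instantiation dual_ball :: (real_normed_vector) metric_space
begin

definition dist_dual_ball :: "'a dual_ball \<Rightarrow> 'a dual_ball \<Rightarrow> real"
  where "dist_dual_ball x y = norm (functional_of x - functional_of y)"

definition uniformity_dual_ball :: "('a dual_ball \<times> 'a dual_ball) filter"
  where "uniformity_dual_ball = (INF e\<in>{0 <..}. principal {(x, y). dist x y < e})"

definition open_dual_ball :: "'a dual_ball set \<Rightarrow> bool"
  where "open_dual_ball S = (\<forall>x\<in>S. \<forall>\<^sub>F (x', y) in uniformity. x' = x \<longrightarrow> y \<in> S)"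

instance
proof
  fix x y z :: "'a dual_ball"
  show "dist x y = 0 \<longleftrightarrow> x = y"
    by (simp add: dist_dual_ball_def functional_of_inject)
  show "dist x y \<le> dist x z + dist y z"
    unfolding dist_dual_ball_def dist_norm[symmetric] by (rule dist_triangle2)
qed (rule uniformity_dual_ball_def open_dual_ball_def)+

end

definition infinite_dimensional :: "'a::real_vector itself \<Rightarrow> bool"
  where "infinite_dimensional T \<longleftrightarrow> \<not> (\<exists>B::'a set. finite B \<and> span B = UNIV)"

definition equicontinuous_on :: "'a::metric_space set \<Rightarrow> ('a \<Rightarrow> 'b::metric_space) set \<Rightarrow> bool"
  where "equicontinuous_on S G \<longleftrightarrow>
    (\<forall>t\<in>S. \<forall>e>0. \<exists>d>0. \<forall>g\<in>G. \<forall>s\<in>S. dist s t < d \<longrightarrow> dist (g s) (g t) < e)"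

definition strongly_measurable :: "'a measure \<Rightarrow> ('a \<Rightarrow> 'b::real_normed_vector) \<Rightarrow> bool"
  where "strongly_measurable M f \<longleftrightarrow>
    (\<exists>s::nat \<Rightarrow> 'a \<Rightarrow> 'b. (\<forall>n. simple_function M (s n)) \<and>
      (AE t in M. (\<lambda>n. s n t) \<longlonglongrightarrow> f t))"

definition support_fun :: "('i \<Rightarrow> 'a::real_normed_vector) set \<Rightarrow> 'i \<Rightarrow> 'a dual_ball \<Rightarrow> real"
  where "support_fun G t x = (SUP g\<in>G. blinfun_apply (functional_of x) (g t))"

(* Only meaningful at t when the suprema in support_fun are finite and support_fun G t is in
   bcontfun: the real supremum and Bcontfun are unspecified otherwise. *)
definition JJ :: "('i \<Rightarrow> 'a::real_normed_vector) set \<Rightarrow> 'i \<Rightarrow> ('a dual_ball \<Rightarrow>\<^sub>C real)"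
  where "JJ G t = Bcontfun (support_fun G t)"

end

theory Submission
  imports Defs
begin

text \<open>Equicontinuity at \<open>t\<close> makes \<open>{g t |. g \<in> G}\<close> bounded as soon as \<open>{g s |. g \<in> G}\<close> is bounded for a
  single \<open>s\<close> near \<open>t\<close>, and every neighbourhood of \<open>t\<close> meets the set of full measure where this holds.
  So \<open>G\<close> is pointwise bounded on all of \<open>I\<close>, and since suprema are nonexpansive,
  \<open>support_fun G t\<close> is Lipschitz on the dual ball and \<open>JJ G\<close> inherits the modulus of continuity of \<open>G\<close>.\<close>

lemma abs_cSUP_diff_le:
  fixes f h :: "'b \<Rightarrow> real"
  assumes "A \<noteq> {}" "bdd_above (f ` A)" "bdd_above (h ` A)"
    and "\<And>z. z \<in> A \<Longrightarrow> \<bar>f z - h z\<bar> \<le> e"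
  shows "\<bar>(SUP z\<in>A. f z) - (SUP z\<in>A. h z)\<bar> \<le> e"
proof -
  \<comment> \<open>The one-sided estimate is stated for arbitrary \<open>p\<close> and
    \<open>q\<close> so that it applies in both orders.\<close>
  have "(SUP z\<in>A. p z) \<le> (SUP z\<in>A. q z) + e"
    if "bdd_above (q ` A)" "\<And>z. z \<in> A \<Longrightarrow> \<bar>p z - q z\<bar> \<le> e" for p q :: "'b \<Rightarrow> real"
  proof (rule cSUP_least[OF assms(1)])
    fix z assume "z \<in> A"
    then show "p z \<le> (SUP z\<in>A. q z) + e"
      using cSUP_upper[OF \<open>z \<in> A\<close> that(1)] that(2)[OF \<open>z \<in> A\<close>] by linarith
  qed
  from this[of h f] this[of f h] assms show ?thesis
    by (fastforce simp: abs_minus_commute abs_le_iff)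
qed

text \<open>A nondegenerate interval is not negligible, so it cannot lie inside the null set
  \<open>N\<close> that contains all exceptional points. This supplies good points arbitrarily close
  to any given one.\<close>

lemma AE_lebesgue_on_obtain_Icc:
  fixes u v :: real
  assumes "AE t in lebesgue_on S. P t" "S \<in> sets lebesgue" "u < v" "{u..v} \<subseteq> S"
  obtains s where "s \<in> {u..v}" "P s"
proof -
  have "AE t in lebesgue. t \<in> S \<longrightarrow> P t"
    using assms(1,2) by (simp add: AE_restrict_space_iff)
  then obtain N where N: "N \<in> null_sets lebesgue" "{t. \<not> (t \<in> S \<longrightarrow> P t)} \<subseteq> N"
    by (auto simp: eventually_ae_filter)
  have "\<not> negligible {u..v}"
    using assms(3) negligible_interval(1)[of u v] by (simp add: box_real)
  then have "\<not> {u..v} \<subseteq> N"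
    using N(1) negligible_iff_null_sets negligible_subset by blast
  with N(2) assms(4) that show thesis by blast
qed

lemma abs_functional_of_le: "\<bar>blinfun_apply (functional_of x) v\<bar> \<le> norm v"
proof -
  have "norm (functional_of x) \<le> 1"
    using functional_of[of x] by simp
  then have "norm (functional_of x) * norm v \<le> norm v"
    by (simp add: mult_left_le_one_le)
  with norm_blinfun[of "functional_of x" v] show ?thesis by simp
qed

lemma bdd_above_functional_of:
  assumes "bdd_above ((\<lambda>g. norm (g t)) ` G)"
  shows "bdd_above ((\<lambda>g. blinfun_apply (functional_of x) (g t)) ` G)"
proof -
  obtain M where "\<And>g. g \<in> G \<Longrightarrow> norm (g t) \<le> M"
    using assms by (auto simp: bdd_above_def)
  then show ?thesis
    by (intro bdd_aboveI2[where M=M]) (meson abs_functional_of_le abs_le_D1 order_trans)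
qed

text \<open>A bound \<open>M\<close> for all \<open>norm (g t)\<close> serves both as a Lipschitz
  constant in the functional and as a bound for the supremum. Membership in \<open>bcontfun\<close>
  is what makes \<open>JJ G t\<close> meaningful.\<close>

lemma support_fun_bcontfun:
  assumes "G \<noteq> {}" and bdd: "bdd_above ((\<lambda>g. norm (g t)) ` G)"
  shows "support_fun G t \<in> bcontfun"
proof -
  obtain M where M: "\<And>g. g \<in> G \<Longrightarrow> norm (g t) \<le> M"
    using bdd by (auto simp: bdd_above_def)
  then have "0 \<le> M"
    using assms(1) norm_ge_zero order_trans by blast
  have lip: "\<bar>support_fun G t x - support_fun G t y\<bar> \<le> M * dist x y" for x y
    unfolding support_fun_def
  proof (intro abs_cSUP_diff_le bdd_above_functional_of assms)
    fix g assume "g \<in> G"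
    have "\<bar>blinfun_apply (functional_of x - functional_of y) (g t)\<bar> \<le> dist x y * norm (g t)"
      using norm_blinfun[of "functional_of x - functional_of y" "g t"]
      by (simp add: dist_dual_ball_def)
    also have "\<dots> \<le> dist x y * M"
      using M[OF \<open>g \<in> G\<close>] by (simp add: mult_left_mono)
    finally show "\<bar>blinfun_apply (functional_of x) (g t) - blinfun_apply (functional_of y) (g t)\<bar>
        \<le> M * dist x y"
      by (simp add: blinfun.diff_left mult.commute)
  qed
  have "M-lipschitz_on UNIV (support_fun G t)"
    using lip \<open>0 \<le> M\<close> by (intro lipschitz_onI) (simp_all add: dist_real_def)
  then have "continuous_on UNIV (support_fun G t)"
    by (rule lipschitz_on_continuous_on)
  moreover have "norm (support_fun G t x) \<le> M" for x
  proof -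
    \<comment> \<open>Comparison with the zero family, whose supremum is 0 because \<open>G\<close>
      is nonempty, turns the bound into another case of nonexpansiveness.\<close>
    have "\<bar>support_fun G t x - (SUP g\<in>G. 0)\<bar> \<le> M"
      unfolding support_fun_def
      by (intro abs_cSUP_diff_le bdd_above_functional_of assms)
        (use M in \<open>auto intro: order_trans[OF abs_functional_of_le]\<close>)
    with assms(1) show ?thesis by simp
  qed
  ultimately show ?thesis
    by (rule bcontfun_normI)
qed

text \<open>Functionals of norm at most 1 do not increase distances, so the estimate is uniform in
  \<open>x\<close> and passes to the sup-norm.\<close>

lemma dist_JJ_le:
  assumes "G \<noteq> {}"
    and "bdd_above ((\<lambda>g. norm (g s)) ` G)" "bdd_above ((\<lambda>g. norm (g t)) ` G)"
    and "\<And>g. g \<in> G \<Longrightarrow> dist (g s) (g t) \<le> e"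
  shows "dist (JJ G s) (JJ G t) \<le> e"
proof (rule dist_bound)
  fix x :: "'b dual_ball"
  have "\<bar>support_fun G s x - support_fun G t x\<bar> \<le> e"
    unfolding support_fun_def
  proof (intro abs_cSUP_diff_le bdd_above_functional_of assms)
    fix g assume "g \<in> G"
    then show "\<bar>blinfun_apply (functional_of x) (g s) - blinfun_apply (functional_of x) (g t)\<bar> \<le> e"
      using abs_functional_of_le[of x "g s - g t"] assms(4)[OF \<open>g \<in> G\<close>]
      by (simp add: blinfun.diff_right dist_norm)
  qed
  then show "dist (apply_bcontfun (JJ G s) x) (apply_bcontfun (JJ G t) x) \<le> e"
    using assms by (simp add: JJ_def Bcontfun_inverse support_fun_bcontfun dist_real_def)
qed

lemma equicontinuous_on_bdd_above_norm:
  fixes G :: "(real \<Rightarrow> 'a::real_normed_vector) set"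
  assumes "a > 0" "equicontinuous_on {0..a} G"
    and ae: "AE t in lebesgue_on {0..a}. bdd_above ((\<lambda>g. norm (g t)) ` G)"
    and t: "t \<in> {0..a}"
  shows "bdd_above ((\<lambda>g. norm (g t)) ` G)"
proof -
  obtain d where d: "d > 0"
    "\<And>g s. g \<in> G \<Longrightarrow> s \<in> {0..a} \<Longrightarrow> dist s t < d \<Longrightarrow> dist (g s) (g t) < 1"
    using assms(2) t unfolding equicontinuous_on_def by (meson zero_less_one)
  \<comment> \<open>Clipping to \<open>{0..a}\<close> covers the endpoints, and \<open>a > 0\<close>
    keeps the interval nondegenerate. The radius \<open>d/2\<close> gives the strict bound
    \<open>dist s t < d\<close>.\<close>
  let ?u = "max 0 (t - d/2)" and ?v = "min a (t + d/2)"
  have "?u < ?v" "{?u..?v} \<subseteq> {0..a}"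
    using t d(1) assms(1) by auto
  then obtain s where s: "s \<in> {?u..?v}" "bdd_above ((\<lambda>g. norm (g s)) ` G)"
    by (rule AE_lebesgue_on_obtain_Icc[OF ae, rotated]) auto
  then have "s \<in> {0..a}" "dist s t < d"
    using d(1) by (auto simp: dist_real_def abs_less_iff)
  obtain M where M: "\<And>g. g \<in> G \<Longrightarrow> norm (g s) \<le> M"
    using s(2) by (auto simp: bdd_above_def)
  show ?thesis
  proof (rule bdd_aboveI2)
    fix g assume g: "g \<in> G"
    have "norm (g t) \<le> norm (g s) + dist (g s) (g t)"
      by (metis dist_norm norm_minus_commute norm_triangle_sub)
    then show "norm (g t) \<le> M + 1"
      using M[OF g] d(2)[OF g \<open>s \<in> {0..a}\<close> \<open>dist s t < d\<close>] by linarith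
  qed
qed

text \<open>Discretizing the argument rather than the values gives simple functions
  \<open>f (r n t)\<close> whatever the target space is.\<close>

lemma continuous_on_imp_strongly_measurable:
  fixes f :: "real \<Rightarrow> 'b::real_normed_vector"
  assumes "continuous_on {0..a} f"
  shows "strongly_measurable (lebesgue_on {0..a}) f"
proof -
  \<comment> \<open>Rounding down to a multiple of \<open>1/n\<close>; division by zero makes
    \<open>r 0\<close> constantly 0.\<close>
  define r :: "nat \<Rightarrow> real \<Rightarrow> real" where "r n t = \<lfloor>real n * t\<rfloor> / n" for n t
  have "simple_function (lebesgue_on {0..a}) (r n)" for n
  proof (rule simple_function_borel_measurable)
    have "r n \<in> borel_measurable lborel"
      unfolding r_def by measurable
    then show "r n \<in> borel_measurable (lebesgue_on {0..a})"
      by (intro measurable_restrict_space1 measurable_completion)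
    have "r n ` {0..a} \<subseteq> (\<lambda>k. real_of_int k / n) ` {0..\<lfloor>real n * a\<rfloor>}"
      by (auto simp: r_def intro!: imageI floor_mono mult_left_mono)
    then show "finite (r n ` space (lebesgue_on {0..a}))"
      by (simp add: finite_subset)
  qed
  then have "simple_function (lebesgue_on {0..a}) (\<lambda>t. f (r n t))" for n
    by (rule simple_function_compose1)
  moreover have "(\<lambda>n. f (r n t)) \<longlonglongrightarrow> f t" if t: "t \<in> {0..a}" for t
  proof (rule continuous_on_tendsto_compose[OF assms _ t])
    have *: "t - 1 / n \<le> r n t \<and> r n t \<le> t" if "n > 0" for n
    proof -
      have "(real n * t - 1) / n \<le> r n t" "r n t \<le> real n * t / n"
        unfolding r_def by (intro divide_right_mono; linarith)+
      with that show ?thesis by (simp add: diff_divide_distrib)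
    qed
    show "(\<lambda>n. r n t) \<longlonglongrightarrow> t"
    proof (rule tendsto_sandwich[where h="\<lambda>_. t"])
      show "(\<lambda>n. t - 1 / real n) \<longlonglongrightarrow> t"
        using tendsto_diff[OF tendsto_const lim_1_over_n, of t] by simp
    qed (use * in \<open>auto intro!: eventually_sequentiallyI[of 1]\<close>)
    \<comment> \<open>Continuity is known only on \<open>{0..a}\<close>. Rounding down never
      overshoots \<open>a\<close>, and \<open>t \<ge> 0\<close> keeps the result
      nonnegative.\<close>
    show "\<forall>\<^sub>F n in sequentially. r n t \<in> {0..a}"
    proof (rule eventually_sequentiallyI[of 1])
      fix n :: nat assume "1 \<le> n"
      then show "r n t \<in> {0..a}"
        using *[of n] t by (auto simp: r_def)
    qed
  qed
  ultimately show ?thesis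
    unfolding strongly_measurable_def
    by (intro exI[of _ "\<lambda>n t. f (r n t)"] conjI allI AE_I2) auto
qed

text \<open>The first conjunct ensures that the suprema are finite and that \<open>JJ G t\<close> is
  the intended function, not an unspecified value.\<close>

theorem theorem5p3:
  fixes G :: "(real \<Rightarrow> 'a::banach) set" and a :: real
  assumes "infinite_dimensional TYPE('a)"
    and "a > 0"
    and "G \<noteq> {}"
    and "\<forall>g\<in>G. continuous_on {0..a} g"
    and "equicontinuous_on {0..a} G"
    and "AE t in lebesgue_on {0..a}. bdd_above ((\<lambda>g. norm (g t)) ` G)"
  shows "(\<forall>t\<in>{0..a}.
            (\<forall>x::'a dual_ball. bdd_above ((\<lambda>g. blinfun_apply (functional_of x) (g t)) ` G)) \<and>
            support_fun G t \<in> bcontfun) \<and>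
         continuous_on {0..a} (JJ G) \<and>
         strongly_measurable (lebesgue_on {0..a}) (JJ G)"
proof -
  have bdd: "bdd_above ((\<lambda>g. norm (g t)) ` G)" if "t \<in> {0..a}" for t
    by (rule equicontinuous_on_bdd_above_norm[OF assms(2,5,6) that])
  have cont: "continuous_on {0..a} (JJ G)"
    unfolding continuous_on_iff
  proof (intro ballI allI impI)
    fix t e :: real assume t: "t \<in> {0..a}" and "e > 0"
    \<comment> \<open>Half of \<open>e\<close> is used because \<open>dist_JJ_le\<close> yields only
      a non-strict bound.\<close>
    then obtain d where d: "d > 0"
      "\<And>g s. g \<in> G \<Longrightarrow> s \<in> {0..a} \<Longrightarrow> dist s t < d \<Longrightarrow> dist (g s) (g t) < e / 2"
      using assms(5) unfolding equicontinuous_on_def by (meson half_gt_zero)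
    have "dist (JJ G s) (JJ G t) < e" if "s \<in> {0..a}" "dist s t < d" for s
    proof -
      have "dist (JJ G s) (JJ G t) \<le> e / 2"
        using d(2) that t by (intro dist_JJ_le bdd assms(3)) (auto intro: less_imp_le)
      with \<open>e > 0\<close> show ?thesis by linarith
    qed
    with d(1) show "\<exists>d>0. \<forall>s\<in>{0..a}. dist s t < d \<longrightarrow> dist (JJ G s) (JJ G t) < e"
      by blast
  qed
  show ?thesis
    by (intro conjI ballI allI bdd_above_functional_of support_fun_bcontfun bdd assms(3) cont
        continuous_on_imp_strongly_measurable)
qed

end
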